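(* Let $(\mathcal{C},\otimes,I)$ be a monoidal category and let $C$ and $D$ be two objects of $\mathcal{C}$ such that $C\otimes D$ is a semisimple object of $\mathcal{C}$. Then the following hold: (1) If $D$ has a strong right dual and the functor $-\otimes D:\mathcal{C}\to\mathcal{C}$ preserves monomorphisms, then $C$ is semisimple in $\mathcal{C}$. (2) If $C$ has a strong left dual and the functor $C\otimes -:\mathcal{C}\to\mathcal{C}$ preserves monomorphisms, then $D$ is semisimple in $\mathcal{C}$. In particular, if $\mathcal{C}$ is a monoidal category in which every object has strong left and right duals and the functors $C\otimes -:\mathcal{C}\to\mathcal{C}$ and $-\otimes C:\mathcal{C}\to\mathcal{C}$ preserve monomorphisms for all $C\in\mathcal{C}$, then $\mathcal{C}$ is a Serre category.
   Context: A morphism $f:C\to D$ in a category $\mathcal{C}$ is a split mono if there is a morphism $g:D\to C$ in $\mathcal{C}$ with $g\circ f=\mathrm{Id}_C$. An object $D$ of $\mathcal{C}$ is semisimple if every monomorphism $f:C\to D$ in $\mathcal{C}$ is a split mono. In a monoidal category $(\mathcal{C},\otimes,I)$, an object $D$ has a strong right dual if there exist an object $D^*\in\mathcal{C}$ and a split mono $i_D:I\to D\otimes D^*$ in $\mathcal{C}$. An object $C$ has a strong left dual if there exist an object $C^*\in\mathcal{C}$ and a split mono $i_C:I\to C^*\otimes C$ in $\mathcal{C}$. (No further duality axioms are required.) The monoidal category $\mathcal{C}$ is a Serre category if for all $C,D\in\mathcal{C}$ such that $C\otimes D$ is semisimple, both $C$ and $D$ are semisimple objects of $\mathcal{C}$.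 *)

theory Defs
  imports Main
begin

record ('o, 'a) category_data =
  Obj :: "'o set"
  Arr :: "'a set"
  Dom :: "'a \<Rightarrow> 'o"
  Cod :: "'a \<Rightarrow> 'o"
  Ident :: "'o \<Rightarrow> 'a"
  Comp :: "'a \<Rightarrow> 'a \<Rightarrow> 'a"  (infixr "\<cdot>\<index>" 75)

definition hom :: "('o, 'a, 'm) category_data_scheme \<Rightarrow> 'o \<Rightarrow> 'o \<Rightarrow> 'a set" where
  "hom \<C> A B = {f \<in> Arr \<C>. Dom \<C> f = A \<and> Cod \<C> f = B}"

text \<open>Composition is in applicative order and is only meaningful on composable pairs: nothing is
  assumed about the value of \<open>g \<cdot> f\<close> otherwise, nor about any operation outside its carrier.\<close>

locale category =
  fixes \<C> :: "('o, 'a, 'm) category_data_scheme" (structure)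
  assumes Dom_closed: "f \<in> Arr \<C> \<Longrightarrow> Dom \<C> f \<in> Obj \<C>"
    and Cod_closed: "f \<in> Arr \<C> \<Longrightarrow> Cod \<C> f \<in> Obj \<C>"
    and Ident_in_hom: "A \<in> Obj \<C> \<Longrightarrow> Ident \<C> A \<in> hom \<C> A A"
    and Comp_in_hom: "\<lbrakk>f \<in> hom \<C> A B; g \<in> hom \<C> B C\<rbrakk> \<Longrightarrow> g \<cdot> f \<in> hom \<C> A C"
    and Comp_assoc: "\<lbrakk>f \<in> hom \<C> A B; g \<in> hom \<C> B C; h \<in> hom \<C> C D\<rbrakk>
          \<Longrightarrow> (h \<cdot> g) \<cdot> f = h \<cdot> (g \<cdot> f)"
    and Comp_Ident_left: "f \<in> hom \<C> A B \<Longrightarrow> Ident \<C> B \<cdot> f = f"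
    and Comp_Ident_right: "f \<in> hom \<C> A B \<Longrightarrow> f \<cdot> Ident \<C> A = f"

definition monomorphism :: "('o, 'a, 'm) category_data_scheme \<Rightarrow> 'a \<Rightarrow> bool" where
  "monomorphism \<C> f \<longleftrightarrow> f \<in> Arr \<C> \<and>
     (\<forall>A\<in>Obj \<C>. \<forall>g\<in>hom \<C> A (Dom \<C> f). \<forall>h\<in>hom \<C> A (Dom \<C> f).
        f \<cdot>\<^bsub>\<C>\<^esub> g = f \<cdot>\<^bsub>\<C>\<^esub> h \<longrightarrow> g = h)"

definition split_mono :: "('o, 'a, 'm) category_data_scheme \<Rightarrow> 'a \<Rightarrow> bool" where
  "split_mono \<C> f \<longleftrightarrow> f \<in> Arr \<C> \<and>
     (\<exists>g\<in>hom \<C> (Cod \<C> f) (Dom \<C> f). g \<cdot>\<^bsub>\<C>\<^esub> f = Ident \<C> (Dom \<C> f))"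

definition isomorphism :: "('o, 'a, 'm) category_data_scheme \<Rightarrow> 'a \<Rightarrow> bool" where
  "isomorphism \<C> f \<longleftrightarrow> f \<in> Arr \<C> \<and>
     (\<exists>g\<in>hom \<C> (Cod \<C> f) (Dom \<C> f).
        g \<cdot>\<^bsub>\<C>\<^esub> f = Ident \<C> (Dom \<C> f) \<and> f \<cdot>\<^bsub>\<C>\<^esub> g = Ident \<C> (Cod \<C> f))"

definition semisimple :: "('o, 'a, 'm) category_data_scheme \<Rightarrow> 'o \<Rightarrow> bool" where
  "semisimple \<C> D \<longleftrightarrow> D \<in> Obj \<C> \<and>
     (\<forall>C\<in>Obj \<C>. \<forall>f\<in>hom \<C> C D. monomorphism \<C> f \<longrightarrow> split_mono \<C> f)"

record ('o, 'a) monoidal_data = "('o, 'a) category_data" +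
  tensor_obj :: "'o \<Rightarrow> 'o \<Rightarrow> 'o"  (infixl "\<otimes>\<index>" 80)
  tensor_arr :: "'a \<Rightarrow> 'a \<Rightarrow> 'a"  (infixl "\<odot>\<index>" 80)
  tensor_unit :: 'o  ("\<I>\<index>")
  associator :: "'o \<Rightarrow> 'o \<Rightarrow> 'o \<Rightarrow> 'a"
  left_unitor :: "'o \<Rightarrow> 'a"
  right_unitor :: "'o \<Rightarrow> 'a"

text \<open>Mac Lane's definition, not assumed strict: \<open>\<otimes>\<close> on objects and \<open>\<odot>\<close> on morphisms form a
  bifunctor, the associator and the unitors are natural isomorphisms, and the pentagon and
  triangle identities hold.\<close>

locale monoidal_category = category \<C>
  for \<C> :: "('o, 'a, 'm) monoidal_data_scheme" (structure) +
  assumes unit_closed: "\<I> \<in> Obj \<C>"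
    and tensor_obj_closed: "\<lbrakk>A \<in> Obj \<C>; B \<in> Obj \<C>\<rbrakk> \<Longrightarrow> A \<otimes> B \<in> Obj \<C>"
    and tensor_arr_in_hom: "\<lbrakk>f \<in> hom \<C> A A'; g \<in> hom \<C> B B'\<rbrakk>
          \<Longrightarrow> f \<odot> g \<in> hom \<C> (A \<otimes> B) (A' \<otimes> B')"
    and tensor_Ident: "\<lbrakk>A \<in> Obj \<C>; B \<in> Obj \<C>\<rbrakk>
          \<Longrightarrow> Ident \<C> A \<odot> Ident \<C> B = Ident \<C> (A \<otimes> B)"
    and tensor_Comp: "\<lbrakk>f \<in> hom \<C> A A'; f' \<in> hom \<C> A' A''; g \<in> hom \<C> B B'; g' \<in> hom \<C> B' B''\<rbrakk>
          \<Longrightarrow> (f' \<cdot> f) \<odot> (g' \<cdot> g) = (f' \<odot> g') \<cdot> (f \<odot> g)"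
    and associator_in_hom: "\<lbrakk>A \<in> Obj \<C>; B \<in> Obj \<C>; C \<in> Obj \<C>\<rbrakk>
          \<Longrightarrow> associator \<C> A B C \<in> hom \<C> ((A \<otimes> B) \<otimes> C) (A \<otimes> (B \<otimes> C))"
    and associator_iso: "\<lbrakk>A \<in> Obj \<C>; B \<in> Obj \<C>; C \<in> Obj \<C>\<rbrakk>
          \<Longrightarrow> isomorphism \<C> (associator \<C> A B C)"
    and associator_natural: "\<lbrakk>f \<in> hom \<C> A A'; g \<in> hom \<C> B B'; h \<in> hom \<C> C C'\<rbrakk>
          \<Longrightarrow> associator \<C> A' B' C' \<cdot> ((f \<odot> g) \<odot> h) = (f \<odot> (g \<odot> h)) \<cdot> associator \<C> A B C"
    and left_unitor_in_hom: "A \<in> Obj \<C> \<Longrightarrow> left_unitor \<C> A \<in> hom \<C> (\<I> \<otimes> A) A"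
    and left_unitor_iso: "A \<in> Obj \<C> \<Longrightarrow> isomorphism \<C> (left_unitor \<C> A)"
    and left_unitor_natural: "f \<in> hom \<C> A B
          \<Longrightarrow> left_unitor \<C> B \<cdot> (Ident \<C> \<I> \<odot> f) = f \<cdot> left_unitor \<C> A"
    and right_unitor_in_hom: "A \<in> Obj \<C> \<Longrightarrow> right_unitor \<C> A \<in> hom \<C> (A \<otimes> \<I>) A"
    and right_unitor_iso: "A \<in> Obj \<C> \<Longrightarrow> isomorphism \<C> (right_unitor \<C> A)"
    and right_unitor_natural: "f \<in> hom \<C> A B
          \<Longrightarrow> right_unitor \<C> B \<cdot> (f \<odot> Ident \<C> \<I>) = f \<cdot> right_unitor \<C> A"
    and pentagon: "\<lbrakk>A \<in> Obj \<C>; B \<in> Obj \<C>; C \<in> Obj \<C>; D \<in> Obj \<C>\<rbrakk>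
          \<Longrightarrow> (Ident \<C> A \<odot> associator \<C> B C D)
                \<cdot> (associator \<C> A (B \<otimes> C) D \<cdot> (associator \<C> A B C \<odot> Ident \<C> D))
            = associator \<C> A B (C \<otimes> D) \<cdot> associator \<C> (A \<otimes> B) C D"
    and triangle: "\<lbrakk>A \<in> Obj \<C>; B \<in> Obj \<C>\<rbrakk>
          \<Longrightarrow> (Ident \<C> A \<odot> left_unitor \<C> B) \<cdot> associator \<C> A \<I> B
            = right_unitor \<C> A \<odot> Ident \<C> B"

text \<open>Arrow parts of the functors \<open>- \<otimes> D\<close> and \<open>C \<otimes> -\<close>.\<close>

definition tensor_right :: "('o, 'a, 'm) monoidal_data_scheme \<Rightarrow> 'o \<Rightarrow> 'a \<Rightarrow> 'a" where
  "tensor_right \<C> D f = f \<odot>\<^bsub>\<C>\<^esub> Ident \<C> D"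

definition tensor_left :: "('o, 'a, 'm) monoidal_data_scheme \<Rightarrow> 'o \<Rightarrow> 'a \<Rightarrow> 'a" where
  "tensor_left \<C> C f = Ident \<C> C \<odot>\<^bsub>\<C>\<^esub> f"

definition preserves_monos :: "('o, 'a, 'm) category_data_scheme \<Rightarrow> ('a \<Rightarrow> 'a) \<Rightarrow> bool" where
  "preserves_monos \<C> F \<longleftrightarrow> (\<forall>f. monomorphism \<C> f \<longrightarrow> monomorphism \<C> (F f))"

definition has_strong_right_dual :: "('o, 'a, 'm) monoidal_data_scheme \<Rightarrow> 'o \<Rightarrow> bool" where
  "has_strong_right_dual \<C> D \<longleftrightarrow>
     (\<exists>D'\<in>Obj \<C>. \<exists>i\<in>hom \<C> \<I>\<^bsub>\<C>\<^esub> (D \<otimes>\<^bsub>\<C>\<^esub> D'). split_mono \<C> i)"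

definition has_strong_left_dual :: "('o, 'a, 'm) monoidal_data_scheme \<Rightarrow> 'o \<Rightarrow> bool" where
  "has_strong_left_dual \<C> C \<longleftrightarrow>
     (\<exists>C'\<in>Obj \<C>. \<exists>i\<in>hom \<C> \<I>\<^bsub>\<C>\<^esub> (C' \<otimes>\<^bsub>\<C>\<^esub> C). split_mono \<C> i)"

definition serre_category :: "('o, 'a, 'm) monoidal_data_scheme \<Rightarrow> bool" where
  "serre_category \<C> \<longleftrightarrow> monoidal_category \<C> \<and>
     (\<forall>C\<in>Obj \<C>. \<forall>D\<in>Obj \<C>.
        semisimple \<C> (C \<otimes>\<^bsub>\<C>\<^esub> D) \<longrightarrow> semisimple \<C> C \<and> semisimple \<C> D)"

end

(* For f : X -> C, the morphisms (f \<otimes> D) \<otimes> D', f \<otimes> (D \<otimes> D'), f \<otimes> I and f are linked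
   by naturality squares, whose vertical maps are isomorphisms except for the split monos A \<otimes> i_D.
   Split monomorphy is carried along each square towards f, so f is a split mono as soon as f \<otimes> D is.
   The left-handed case is the mirror image. *)
theory Submission
  imports Defs
begin

lemma split_monoI:
  assumes "f \<in> hom \<C> A B" "g \<in> hom \<C> B A" "g \<cdot>\<^bsub>\<C>\<^esub> f = Ident \<C> A"
  shows "split_mono \<C> f"
  using assms by (auto simp: split_mono_def hom_def)

lemma split_monoE:
  assumes "split_mono \<C> f" "f \<in> hom \<C> A B"
  obtains g where "g \<in> hom \<C> B A" "g \<cdot>\<^bsub>\<C>\<^esub> f = Ident \<C> A"
  using assms by (auto simp: split_mono_def hom_def)

lemma isomorphismE:
  assumes "isomorphism \<C> f" "f \<in> hom \<C> A B"
  obtains g where "g \<in> hom \<C> B A" "g \<cdot>\<^bsub>\<C>\<^esub> f = Ident \<C> A" "f \<cdot>\<^bsub>\<C>\<^esub> g = Ident \<C> B"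
  using assms by (auto simp: isomorphism_def hom_def)

lemma isomorphism_imp_split_mono: "isomorphism \<C> f \<Longrightarrow> split_mono \<C> f"
  by (auto simp: isomorphism_def split_mono_def)

context category
begin

lemma hom_Obj: "f \<in> hom \<C> A B \<Longrightarrow> A \<in> Obj \<C>" "f \<in> hom \<C> A B \<Longrightarrow> B \<in> Obj \<C>"
  using Dom_closed Cod_closed by (auto simp: hom_def)

lemma split_mono_Ident:
  assumes "A \<in> Obj \<C>"
  shows "split_mono \<C> (Ident \<C> A)"
  using split_monoI[OF Ident_in_hom Ident_in_hom] Comp_Ident_left[OF Ident_in_hom] assms by blast

lemma split_mono_Comp:
  assumes "f \<in> hom \<C> A B" "g \<in> hom \<C> B C" "split_mono \<C> f" "split_mono \<C> g"
  shows "split_mono \<C> (g \<cdot> f)"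
proof -
  obtain f' where f': "f' \<in> hom \<C> B A" "f' \<cdot> f = Ident \<C> A"
    using split_monoE assms by metis
  obtain g' where g': "g' \<in> hom \<C> C B" "g' \<cdot> g = Ident \<C> B"
    using split_monoE assms by metis
  have gf: "g \<cdot> f \<in> hom \<C> A C"
    using Comp_in_hom assms by blast
  have "(f' \<cdot> g') \<cdot> (g \<cdot> f) = f' \<cdot> ((g' \<cdot> g) \<cdot> f)"
    using Comp_assoc[OF gf g'(1) f'(1)] Comp_assoc[OF assms(1,2) g'(1)] by simp
  also have "\<dots> = Ident \<C> A"
    using f' g' Comp_Ident_left[OF assms(1)] by simp
  finally show ?thesis
    using split_monoI[OF gf Comp_in_hom[OF g'(1) f'(1)]] by blast
qed

text \<open>If \<open>h\<close> is a retraction of \<open>g \<cdot> f\<close>, then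
  \<open>h \<cdot> g\<close> is a retraction of \<open>f\<close>.\<close>

lemma split_mono_right_factor:
  assumes f: "f \<in> hom \<C> A B" and g: "g \<in> hom \<C> B C" and "split_mono \<C> (g \<cdot> f)"
  shows "split_mono \<C> f"
proof -
  obtain h where h: "h \<in> hom \<C> C A" "h \<cdot> (g \<cdot> f) = Ident \<C> A"
    using split_monoE[OF assms(3) Comp_in_hom[OF f g]] by blast
  then show ?thesis
    using split_monoI[OF f Comp_in_hom[OF g h(1)]] Comp_assoc[OF f g h(1)] by simp
qed

text \<open>The diagonal \<open>f \<cdot> u\<close> is a split mono, and \<open>g\<close> is a right
  factor of it, since \<open>v \<cdot> g\<close> is the same morphism. Splitness is thus carried
  against the direction of the vertical maps.\<close>

lemma split_mono_square_left:
  assumes "g \<in> hom \<C> X Y" "f \<in> hom \<C> X' Y'" "u \<in> hom \<C> X X'" "v \<in> hom \<C> Y Y'"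
    and "v \<cdot> g = f \<cdot> u" "split_mono \<C> u" "split_mono \<C> f"
  shows "split_mono \<C> g"
  using split_mono_right_factor[OF assms(1,4)] split_mono_Comp[OF assms(3,2,6,7)] assms(5) by simp

text \<open>Splitness is now carried along the vertical maps. The morphism \<open>f\<close> is a
  left factor of the diagonal, and left factors do not inherit splitness in general, so
  \<open>u\<close> is cancelled by composing with its inverse.\<close>

lemma split_mono_square_right:
  assumes g: "g \<in> hom \<C> X Y" and f: "f \<in> hom \<C> X' Y'"
    and u: "u \<in> hom \<C> X X'" and v: "v \<in> hom \<C> Y Y'"
    and eq: "v \<cdot> g = f \<cdot> u" and "isomorphism \<C> u" "split_mono \<C> v" "split_mono \<C> g"
  shows "split_mono \<C> f"
proof -
  obtain w where w: "w \<in> hom \<C> X' X" "w \<cdot> u = Ident \<C> X" "u \<cdot> w = Ident \<C> X'"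
    using isomorphismE[OF assms(6) u] by blast
  have "split_mono \<C> (f \<cdot> u)"
    using split_mono_Comp[OF g v assms(8,7)] eq by simp
  \<comment> \<open>The retraction of \<open>w\<close> is \<open>u\<close> itself.\<close>
  moreover have "split_mono \<C> w"
    using split_monoI[OF w(1) u w(3)] .
  ultimately have "split_mono \<C> ((f \<cdot> u) \<cdot> w)"
    using split_mono_Comp[OF w(1) Comp_in_hom[OF u f]] by blast
  then show ?thesis
    using Comp_assoc[OF w(1) u f] w(3) Comp_Ident_right[OF f] by simp
qed

end

context monoidal_category
begin

text \<open>By bifunctoriality, the tensor product of two retractions is a retraction of the tensor
  product.\<close>

lemma split_mono_tensor_arr:
  assumes f: "f \<in> hom \<C> A A'" and g: "g \<in> hom \<C> B B'" and "split_mono \<C> f" "split_mono \<C> g"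
  shows "split_mono \<C> (f \<odot> g)"
proof -
  obtain f' where f': "f' \<in> hom \<C> A' A" "f' \<cdot> f = Ident \<C> A"
    using split_monoE assms by metis
  obtain g' where g': "g' \<in> hom \<C> B' B" "g' \<cdot> g = Ident \<C> B"
    using split_monoE assms by metis
  have "(f' \<odot> g') \<cdot> (f \<odot> g) = Ident \<C> (A \<otimes> B)"
    using tensor_Comp[OF f f'(1) g g'(1)] f' g' tensor_Ident hom_Obj[OF f] hom_Obj[OF g] by simp
  then show ?thesis
    using split_monoI[OF tensor_arr_in_hom[OF f g] tensor_arr_in_hom[OF f'(1) g'(1)]] by blast
qed

text \<open>By bifunctoriality both sides equal \<open>f \<odot> g\<close> in the first equation and
  \<open>g \<odot> f\<close> in the second. With the split mono of a strong dual as
  \<open>g\<close>, these are the squares that compare tensoring \<open>f\<close> with the unit and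
  with the product of an object and its dual.\<close>

lemma tensor_interchange:
  assumes "f \<in> hom \<C> A A'" "g \<in> hom \<C> B B'"
  shows "(Ident \<C> A' \<odot> g) \<cdot> (f \<odot> Ident \<C> B) = (f \<odot> Ident \<C> B') \<cdot> (Ident \<C> A \<odot> g)"
    and "(g \<odot> Ident \<C> A') \<cdot> (Ident \<C> B \<odot> f) = (Ident \<C> B' \<odot> f) \<cdot> (g \<odot> Ident \<C> A)"
proof -
  note ids = hom_Obj[OF assms(1), THEN Ident_in_hom] hom_Obj[OF assms(2), THEN Ident_in_hom]
  note units = assms[THEN Comp_Ident_left] assms[THEN Comp_Ident_right]
  show "(Ident \<C> A' \<odot> g) \<cdot> (f \<odot> Ident \<C> B) = (f \<odot> Ident \<C> B') \<cdot> (Ident \<C> A \<odot> g)"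
    using tensor_Comp[OF assms(1) ids(2) ids(3) assms(2)]
      tensor_Comp[OF ids(1) assms(1) assms(2) ids(4)] units by simp
  show "(g \<odot> Ident \<C> A') \<cdot> (Ident \<C> B \<odot> f) = (Ident \<C> B' \<odot> f) \<cdot> (g \<odot> Ident \<C> A)"
    using tensor_Comp[OF ids(3) assms(2) assms(1) ids(2)]
      tensor_Comp[OF assms(2) ids(4) ids(1) assms(1)] units by simp
qed

text \<open>The dual undoes the functor \<open>- \<otimes> D\<close>: tensoring once more with
  \<open>D'\<close> amounts to tensoring with \<open>D \<otimes> D'\<close>, of which the unit is a
  retract through \<open>i\<close>.\<close>

lemma split_mono_tensor_right_reflect:
  assumes dual: "has_strong_right_dual \<C> D" and D: "D \<in> Obj \<C>" and f: "f \<in> hom \<C> X C"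
    and split: "split_mono \<C> (tensor_right \<C> D f)"
  shows "split_mono \<C> f"
proof -
  obtain D' i where D': "D' \<in> Obj \<C>" and i: "i \<in> hom \<C> \<I> (D \<otimes> D')" "split_mono \<C> i"
    using dual by (auto simp: has_strong_right_dual_def)
  note objs = hom_Obj[OF f] D D'
  note DD' = tensor_obj_closed[OF D D']
  \<comment> \<open>In order, the identities of \<open>X\<close>, \<open>C\<close>,
    \<open>D\<close>, \<open>D'\<close>, \<open>D \<otimes> D'\<close> and the unit.\<close>
  note ids = objs[THEN Ident_in_hom] DD'[THEN Ident_in_hom] unit_closed[THEN Ident_in_hom]
  note fD = tensor_arr_in_hom[OF f ids(3)]
  note fDD' = tensor_arr_in_hom[OF f ids(5)]
  note fI = tensor_arr_in_hom[OF f ids(6)]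
  have "split_mono \<C> ((f \<odot> Ident \<C> D) \<odot> Ident \<C> D')"
    using split_mono_tensor_arr[OF fD ids(4)] split split_mono_Ident[OF D']
    by (simp add: tensor_right_def)
  then have "split_mono \<C> (f \<odot> Ident \<C> (D \<otimes> D'))"
    using split_mono_square_right[OF tensor_arr_in_hom[OF fD ids(4)] fDD'
        associator_in_hom associator_in_hom]
      associator_natural[OF f ids(3,4)] tensor_Ident
      associator_iso associator_iso[THEN isomorphism_imp_split_mono] objs
    by simp
  \<comment> \<open>The vertical maps, identities tensored with \<open>i\<close>, are only known to
    be split monos. They start on the unit side, so the unit side is the right factor of the
    diagonal and inherits splitness.\<close>
  then have "split_mono \<C> (f \<odot> Ident \<C> \<I>)"
    using split_mono_square_left[OF fI fDD' tensor_arr_in_hom[OF ids(1) i(1)]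
        tensor_arr_in_hom[OF ids(2) i(1)] tensor_interchange(1)[OF f i(1)]]
      split_mono_tensor_arr[OF ids(1) i(1)] split_mono_Ident i(2) objs by blast
  then show ?thesis
    using split_mono_square_right[OF fI f right_unitor_in_hom right_unitor_in_hom
        right_unitor_natural[OF f]]
      right_unitor_iso right_unitor_iso[THEN isomorphism_imp_split_mono] objs by blast
qed

lemma split_mono_tensor_left_reflect:
  assumes dual: "has_strong_left_dual \<C> C" and C: "C \<in> Obj \<C>" and f: "f \<in> hom \<C> X D"
    and split: "split_mono \<C> (tensor_left \<C> C f)"
  shows "split_mono \<C> f"
proof -
  obtain C' i where C': "C' \<in> Obj \<C>" and i: "i \<in> hom \<C> \<I> (C' \<otimes> C)" "split_mono \<C> i"
    using dual by (auto simp: has_strong_left_dual_def)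
  note objs = hom_Obj[OF f] C C'
  note C'C = tensor_obj_closed[OF C' C]
  note ids = objs[THEN Ident_in_hom] C'C[THEN Ident_in_hom] unit_closed[THEN Ident_in_hom]
  note Cf = tensor_arr_in_hom[OF ids(3) f]
  note C'Cf = tensor_arr_in_hom[OF ids(5) f]
  note If = tensor_arr_in_hom[OF ids(6) f]
  have "split_mono \<C> (Ident \<C> C' \<odot> (Ident \<C> C \<odot> f))"
    using split_mono_tensor_arr[OF ids(4) Cf] split split_mono_Ident[OF C']
    by (simp add: tensor_left_def)
  \<comment> \<open>The mirror image reverses the associator: the morphism already known to split
    now lies on its target side, so the square is used in the opposite direction to the right-handed
    case.\<close>
  then have "split_mono \<C> (Ident \<C> (C' \<otimes> C) \<odot> f)"
    using split_mono_square_left[OF C'Cf tensor_arr_in_hom[OF ids(4) Cf]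
        associator_in_hom associator_in_hom]
      associator_natural[OF ids(4,3) f] tensor_Ident
      associator_iso associator_iso[THEN isomorphism_imp_split_mono] objs
    by simp
  then have "split_mono \<C> (Ident \<C> \<I> \<odot> f)"
    using split_mono_square_left[OF If C'Cf tensor_arr_in_hom[OF i(1) ids(1)]
        tensor_arr_in_hom[OF i(1) ids(2)] tensor_interchange(2)[OF f i(1)]]
      split_mono_tensor_arr[OF i(1) ids(1)] split_mono_Ident i(2) objs by blast
  then show ?thesis
    using split_mono_square_right[OF If f left_unitor_in_hom left_unitor_in_hom
        left_unitor_natural[OF f]]
      left_unitor_iso left_unitor_iso[THEN isomorphism_imp_split_mono] objs by blast
qed

text \<open>A mono \<open>f\<close> into \<open>C\<close> becomes a mono into the semisimple object
  \<open>C \<otimes> D\<close>, hence splits there, and the strong right dual of \<open>D\<close>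
  brings the splitting back to \<open>f\<close>.\<close>

lemma semisimple_left_factor:
  assumes "C \<in> Obj \<C>" "D \<in> Obj \<C>" "semisimple \<C> (C \<otimes> D)"
    and "has_strong_right_dual \<C> D" "preserves_monos \<C> (tensor_right \<C> D)"
  shows "semisimple \<C> C"
  unfolding semisimple_def
proof (intro conjI ballI impI)
  fix X f assume f: "f \<in> hom \<C> X C" "monomorphism \<C> f"
  have "tensor_right \<C> D f \<in> hom \<C> (X \<otimes> D) (C \<otimes> D)"
    using tensor_arr_in_hom[OF f(1) Ident_in_hom] assms(2) by (simp add: tensor_right_def)
  then have "split_mono \<C> (tensor_right \<C> D f)"
    using assms(3,5) f(2) hom_Obj unfolding semisimple_def preserves_monos_def by blast
  then show "split_mono \<C> f"
    using split_mono_tensor_right_reflect assms(2,4) f(1) by blast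
qed (fact assms(1))

lemma semisimple_right_factor:
  assumes "C \<in> Obj \<C>" "D \<in> Obj \<C>" "semisimple \<C> (C \<otimes> D)"
    and "has_strong_left_dual \<C> C" "preserves_monos \<C> (tensor_left \<C> C)"
  shows "semisimple \<C> D"
  unfolding semisimple_def
proof (intro conjI ballI impI)
  fix X f assume f: "f \<in> hom \<C> X D" "monomorphism \<C> f"
  have "tensor_left \<C> C f \<in> hom \<C> (C \<otimes> X) (C \<otimes> D)"
    using tensor_arr_in_hom[OF Ident_in_hom f(1)] assms(1) by (simp add: tensor_left_def)
  then have "split_mono \<C> (tensor_left \<C> C f)"
    using assms(3,5) f(2) hom_Obj unfolding semisimple_def preserves_monos_def by blast
  then show "split_mono \<C> f"
    using split_mono_tensor_left_reflect assms(1,4) f(1) by blast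
qed (fact assms(2))

end

theorem proposition1p1:
  fixes \<C> :: "('o, 'a, 'm) monoidal_data_scheme"
  assumes "monoidal_category \<C>"
  shows "(\<forall>C\<in>Obj \<C>. \<forall>D\<in>Obj \<C>. semisimple \<C> (C \<otimes>\<^bsub>\<C>\<^esub> D) \<longrightarrow>
            (has_strong_right_dual \<C> D \<and> preserves_monos \<C> (tensor_right \<C> D) \<longrightarrow> semisimple \<C> C) \<and>
            (has_strong_left_dual \<C> C \<and> preserves_monos \<C> (tensor_left \<C> C) \<longrightarrow> semisimple \<C> D))
       \<and> ((\<forall>C\<in>Obj \<C>. has_strong_left_dual \<C> C \<and> has_strong_right_dual \<C> C \<and>
              preserves_monos \<C> (tensor_left \<C> C) \<and> preserves_monos \<C> (tensor_right \<C> C))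
          \<longrightarrow> serre_category \<C>)"
proof -
  interpret monoidal_category \<C> by (fact assms)
  show ?thesis
    \<comment> \<open>For the Serre property, the right dual of \<open>D\<close> gives
      semisimplicity of \<open>C\<close>, and the left dual of \<open>C\<close> gives that of
      \<open>D\<close>.\<close>
    unfolding serre_category_def
    using assms semisimple_left_factor semisimple_right_factor by blast
qed

end
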